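(* (a) Let $ABC$ be a (non-degenerate) triangle in the Euclidean plane and let $k>0$ be a real constant. If the locus $S_k(\Delta ABC)$ of points in the plane whose sum of squared distances to the three sides of $ABC$ equals $k$ contains more than one point, then $S_k(\Delta ABC)$ is an ellipse. (b) Conversely, for every ellipse $E$ in the Euclidean plane there exist a (non-degenerate) triangle $ABC$ and a constant $k>0$ such that $E=S_k(\Delta ABC)$.
   Context: For a non-degenerate triangle $\Delta$ in the Euclidean plane and a real $k>0$, $S_k(\Delta)$ denotes the set of all points $P$ of the plane such that $d_1(P)^2+d_2(P)^2+d_3(P)^2=k$, where $d_1(P),d_2(P),d_3(P)$ are the distances from $P$ to the three lines containing the sides of $\Delta$. Circles are regarded as ellipses; an ellipse is a curve which in suitable Cartesian coordinates has the form $x^2/\alpha^2+y^2/\beta^2=1$ with $\alpha\ge\beta>0$. *)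

theory Defs
  imports "HOL-Analysis.Analysis"
begin

(* Degenerate triples A, B, C are excluded in the theorem by the hypothesis ~ collinear {A, B, C}. *)
definition sq_dist_locus :: "real^2 \<Rightarrow> real^2 \<Rightarrow> real^2 \<Rightarrow> real \<Rightarrow> (real^2) set" where
  "sq_dist_locus A B C k =
     {P. (infdist P (affine hull {B, C}))\<^sup>2 + (infdist P (affine hull {C, A}))\<^sup>2
         + (infdist P (affine hull {A, B}))\<^sup>2 = k}"

(* A Cartesian coordinate system is an origin c together with an orthonormal pair of axes u, v. *)
definition is_ellipse :: "(real^2) set \<Rightarrow> bool" where
  "is_ellipse E \<longleftrightarrow>
     (\<exists>c u v \<alpha> \<beta>. norm u = 1 \<and> norm v = 1 \<and> orthogonal u v \<and> \<alpha> \<ge> \<beta> \<and> \<beta> > 0 \<and>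
        E = {c + x *\<^sub>R u + y *\<^sub>R v |x y. x\<^sup>2 / \<alpha>\<^sup>2 + y\<^sup>2 / \<beta>\<^sup>2 = 1})"

end

theory Submission
  imports Defs
begin

text \<open>
  The squared distance from \<open>P\<close> to a line with unit normal \<open>n\<close> is \<open>(n \<bullet> P - c)\<^sup>2\<close>, so the sum of the
  three squared distances is a quadratic polynomial \<open>F\<close> in the coordinates of \<open>P\<close>
  (\<open>sq_dist_locus_by_normals\<close>). Its quadratic part \<open>w \<mapsto> \<Sum>i. (n i \<bullet> w)\<^sup>2\<close> is positive definite, because
  a nonzero \<open>w\<close> orthogonal to all three normals would be parallel to all three sides.

  A rotation of the axes removes the mixed term (\<open>diagonalizing_frame_exists\<close>) and a translation of
  the origin then removes the linear terms (\<open>sum_squares_complete_square\<close>), which leaves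
  \<open>F = m + p x\<^sup>2 + q y\<^sup>2\<close> with \<open>p, q > 0\<close>. The level set \<open>F = k\<close> is empty for \<open>k < m\<close>, a single point
  for \<open>k = m\<close>, and an ellipse with semi-axes \<open>sqrt ((k - m) / p)\<close> and \<open>sqrt ((k - m) / q)\<close> for
  \<open>k > m\<close>.

  Conversely, only the ratio \<open>q / p = \<alpha>\<^sup>2 / \<beta>\<^sup>2 \<ge> 1\<close> and the centre of an ellipse have to be matched; its
  size is then adjusted by \<open>k\<close>. An isosceles triangle with base parallel to the major axis \<open>u\<close> has the
  unit normals \<open>v\<close> and \<open>s v \<plusminus> c u\<close> with \<open>c\<^sup>2 + s\<^sup>2 = 1\<close>, hence \<open>p = 2 c\<^sup>2\<close> and \<open>q = 1 + 2 s\<^sup>2\<close>. The ratio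
  \<open>(1 + 2 s\<^sup>2) / (2 - 2 s\<^sup>2)\<close> increases from \<open>1 / 2\<close> to infinity as \<open>s\<close> runs through \<open>[0, 1)\<close>, so every
  required value is attained.
\<close>

section \<open>Orthonormal frames in the plane\<close>

text \<open>
  In the plane \<open>v\<close> is \<open>u\<close> turned by a right angle up to a sign \<open>t\<close>, so the claim becomes an identity
  in the coordinates of \<open>u\<close> and \<open>P\<close>.
\<close>
lemma orthonormal_frame_expansion:
  fixes u v P :: "real^2"
  assumes "norm u = 1" "norm v = 1" "orthogonal u v"
  shows "P = (u \<bullet> P) *\<^sub>R u + (v \<bullet> P) *\<^sub>R v"
proof -
  have u: "u$1 * u$1 + u$2 * u$2 = 1" and v: "v$1 * v$1 + v$2 * v$2 = 1"
    and o: "u$1 * v$1 + u$2 * v$2 = 0"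
    using assms by (auto simp: norm_eq_1 orthogonal_def inner_vec_def sum_2)
  define t where "t = u$1 * v$2 - u$2 * v$1"
  have "v$1 = v$1 * (u$1 * u$1 + u$2 * u$2) - u$1 * (u$1 * v$1 + u$2 * v$2)"
      "v$2 = v$2 * (u$1 * u$1 + u$2 * u$2) - u$2 * (u$1 * v$1 + u$2 * v$2)"
    using u o by simp_all
  then have v_rot: "v$1 = - t * u$2" "v$2 = t * u$1"
    by (simp_all add: t_def algebra_simps)
  have "t * t * (u$1 * u$1 + u$2 * u$2) = v$1 * v$1 + v$2 * v$2"
    unfolding v_rot by (simp add: algebra_simps)
  then have tt: "t * t = 1"
    unfolding u v by simp
  have "(u$1 * P$1 + u$2 * P$2) * u$1 + (v$1 * P$1 + v$2 * P$2) * v$1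
        = (u$1 * u$1 + t * t * (u$2 * u$2)) * P$1 + (1 - t * t) * (u$1 * u$2 * P$2)"
      "(u$1 * P$1 + u$2 * P$2) * u$2 + (v$1 * P$1 + v$2 * P$2) * v$2
        = (t * t * (u$1 * u$1) + u$2 * u$2) * P$2 + (1 - t * t) * (u$1 * u$2 * P$1)"
    unfolding v_rot by (simp_all add: algebra_simps)
  then have "P$1 = (u$1 * P$1 + u$2 * P$2) * u$1 + (v$1 * P$1 + v$2 * P$2) * v$1"
      "P$2 = (u$1 * P$1 + u$2 * P$2) * u$2 + (v$1 * P$1 + v$2 * P$2) * v$2"
    unfolding tt by (simp_all add: u)
  then show ?thesis
    by (simp add: vec_eq_iff forall_2 inner_vec_def sum_2)
qed

corollary orthonormal_frame_coordinates:
  fixes u v P c :: "real^2"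
  assumes "norm u = 1" "norm v = 1" "orthogonal u v"
  obtains x y where "P = c + x *\<^sub>R u + y *\<^sub>R v"
proof
  show "P = c + (u \<bullet> (P - c)) *\<^sub>R u + (v \<bullet> (P - c)) *\<^sub>R v"
    using orthonormal_frame_expansion[OF assms, of "P - c"] by (simp add: algebra_simps)
qed

lemma perp_unit_vector_exists:
  fixes d :: "real^2"
  obtains n where "norm n = 1" "n \<bullet> d = 0"
proof -
  have "2 \<le> DIM(real^2)" by simp
  then obtain x where x: "x \<noteq> 0" "orthogonal d x"
    by (rule orthogonal_to_vector_exists)
  show ?thesis
    by (rule that[of "x /\<^sub>R norm x"]) (use x in \<open>auto simp: orthogonal_def inner_commute\<close>)
qed

lemma perp_to_same_vector_parallel:
  fixes n w z :: "real^2"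
  assumes "n \<noteq> 0" "w \<noteq> 0" "n \<bullet> w = 0" "n \<bullet> z = 0"
  shows "\<exists>a. z = a *\<^sub>R w"
proof -
  let ?u = "n /\<^sub>R norm n" and ?v = "w /\<^sub>R norm w"
  have "z = (?u \<bullet> z) *\<^sub>R ?u + (?v \<bullet> z) *\<^sub>R ?v"
    using assms by (intro orthonormal_frame_expansion) (auto simp: orthogonal_def)
  then have "z = ((?v \<bullet> z) / norm w) *\<^sub>R w"
    using assms by (simp add: field_simps)
  then show ?thesis ..
qed

section \<open>Squared distances to the sides of a triangle\<close>

lemma affine_hull_2_eq_hyperplane:
  fixes B C n :: "real^2"
  assumes "n \<noteq> 0" "B \<noteq> C" "n \<bullet> B = c" "n \<bullet> C = c"
  shows "affine hull {B, C} = {X. n \<bullet> X = c}"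
proof
  show "affine hull {B, C} \<subseteq> {X. n \<bullet> X = c}"
    by (rule hull_minimal) (use assms in \<open>auto simp: affine_hyperplane\<close>)
  show "{X. n \<bullet> X = c} \<subseteq> affine hull {B, C}"
  proof clarify
    fix X assume "c = n \<bullet> X"
    then obtain a where "X - B = a *\<^sub>R (C - B)"
      using perp_to_same_vector_parallel[of n "C - B" "X - B"] assms
      by (auto simp: inner_diff_right)
    then have "X = (1 - a) *\<^sub>R B + a *\<^sub>R C"
      by (simp add: algebra_simps)
    then show "X \<in> affine hull {B, C}"
      unfolding affine_hull_2 by (metis (mono_tags, lifting) diff_add_cancel mem_Collect_eq)
  qed
qed

lemma infdist_hyperplane:
  fixes n P :: "'a::real_inner"
  assumes "norm n = 1"
  shows "infdist P {X. n \<bullet> X = c} = \<bar>n \<bullet> P - c\<bar>"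
proof -
  have nn: "n \<bullet> n = 1" using assms by (simp add: norm_eq_1)
  \<comment> \<open>The foot of the perpendicular from \<open>P\<close>.\<close>
  define F where "F = P - (n \<bullet> P - c) *\<^sub>R n"
  have F: "F \<in> {X. n \<bullet> X = c}"
    by (simp add: F_def inner_diff_right nn)
  show ?thesis
  proof (rule antisym)
    have "infdist P {X. n \<bullet> X = c} \<le> dist P F"
      using F by (rule infdist_le)
    then show "infdist P {X. n \<bullet> X = c} \<le> \<bar>n \<bullet> P - c\<bar>"
      using assms by (simp add: F_def dist_norm)
    have "\<bar>n \<bullet> P - c\<bar> \<le> dist P X" if "n \<bullet> X = c" for X
    proof -
      have "\<bar>n \<bullet> P - c\<bar> = \<bar>n \<bullet> (P - X)\<bar>"
        using that by (simp add: inner_diff_right)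
      then show ?thesis
        using Cauchy_Schwarz_ineq2[of n "P - X"] assms by (simp add: dist_norm)
    qed
    then show "\<bar>n \<bullet> P - c\<bar> \<le> infdist P {X. n \<bullet> X = c}"
      unfolding infdist_def using F by (auto intro!: cINF_greatest)
  qed
qed

lemma sq_dist_locus_by_normals:
  assumes "norm n1 = 1" "norm n2 = 1" "norm n3 = 1"
    and "B \<noteq> C" "C \<noteq> A" "A \<noteq> B"
    and "n1 \<bullet> B = c1" "n1 \<bullet> C = c1" "n2 \<bullet> C = c2" "n2 \<bullet> A = c2" "n3 \<bullet> A = c3" "n3 \<bullet> B = c3"
  shows "sq_dist_locus A B C k =
    {P. (n1 \<bullet> P - c1)\<^sup>2 + (n2 \<bullet> P - c2)\<^sup>2 + (n3 \<bullet> P - c3)\<^sup>2 = k}"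
proof -
  have ne: "n1 \<noteq> 0" "n2 \<noteq> 0" "n3 \<noteq> 0" using assms(1-3) by auto
  show ?thesis
    unfolding sq_dist_locus_def
      affine_hull_2_eq_hyperplane[OF ne(1) assms(4,7,8)]
      affine_hull_2_eq_hyperplane[OF ne(2) assms(5,9,10)]
      affine_hull_2_eq_hyperplane[OF ne(3) assms(6,11,12)]
    using assms(1-3) by (simp add: infdist_hyperplane)
qed

section \<open>Level sets of sums of squares of affine functions\<close>

lemma is_ellipseI:
  assumes "norm u = 1" "norm v = 1" "orthogonal u v" "\<beta> \<le> \<alpha>" "\<beta> > 0"
  shows "is_ellipse {c + x *\<^sub>R u + y *\<^sub>R v |x y. x\<^sup>2 / \<alpha>\<^sup>2 + y\<^sup>2 / \<beta>\<^sup>2 = 1}"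
  unfolding is_ellipse_def
  by (rule exI[of _ c], rule exI[of _ u], rule exI[of _ v], rule exI[of _ \<alpha>], rule exI[of _ \<beta>])
     (use assms in \<open>simp only: simp_thms\<close>)

text \<open>
  The condition \<open>p \<alpha>\<^sup>2 = q \<beta>\<^sup>2 = k - m\<close> can be read in both directions: it determines the semi-axes from
  a given level \<open>k\<close>, and the level from given semi-axes.
\<close>
lemma level_set_in_frame:
  fixes u v c :: "real^2"
  assumes uv: "norm u = 1" "norm v = 1" "orthogonal u v"
    and F: "\<And>x y. F (c + x *\<^sub>R u + y *\<^sub>R v) = m + p * x\<^sup>2 + q * y\<^sup>2"
    and "\<alpha> > 0" "\<beta> > 0" "k > m" "p * \<alpha>\<^sup>2 = k - m" "q * \<beta>\<^sup>2 = k - m"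
  shows "{P. F P = k} = {c + x *\<^sub>R u + y *\<^sub>R v |x y. x\<^sup>2 / \<alpha>\<^sup>2 + y\<^sup>2 / \<beta>\<^sup>2 = 1}"
proof -
  have pq: "p = (k - m) / \<alpha>\<^sup>2" "q = (k - m) / \<beta>\<^sup>2"
    using assms(5,6,8,9) by (simp_all add: eq_divide_eq)
  have eq: "F (c + x *\<^sub>R u + y *\<^sub>R v) = k \<longleftrightarrow> x\<^sup>2 / \<alpha>\<^sup>2 + y\<^sup>2 / \<beta>\<^sup>2 = 1" for x y
  proof -
    have "F (c + x *\<^sub>R u + y *\<^sub>R v) = m + (k - m) * (x\<^sup>2 / \<alpha>\<^sup>2 + y\<^sup>2 / \<beta>\<^sup>2)"
      unfolding F pq by (simp add: algebra_simps)
    also have "\<dots> = k \<longleftrightarrow> (k - m) * (x\<^sup>2 / \<alpha>\<^sup>2 + y\<^sup>2 / \<beta>\<^sup>2) = (k - m) * 1"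
      by (simp add: eq_diff_eq add.commute)
    finally show ?thesis using \<open>k > m\<close> by simp
  qed
  show ?thesis
    using orthonormal_frame_coordinates[OF uv, of _ c] eq by (auto, metis)
qed

text \<open>
  In the frame rotated by the angle \<open>t\<close> the mixed coefficient is \<open>b cos 2t + a sin 2t\<close>, where \<open>b\<close> is its
  value in the standard frame and \<open>2 a\<close> is the difference of the two diagonal coefficients. Writing
  \<open>(a, b)\<close> in polar form turns this into \<open>r sin (2t + s)\<close>, which vanishes for \<open>t = - s / 2\<close>.
\<close>
lemma diagonalizing_frame_exists:
  fixes n :: "'i \<Rightarrow> real^2"
  obtains u v where "norm u = 1" "norm v = 1" "orthogonal u v"
    "(\<Sum>i\<in>I. (n i \<bullet> u) * (n i \<bullet> v)) = 0"
proof -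
  define a where "a = (\<Sum>i\<in>I. ((n i $ 2)\<^sup>2 - (n i $ 1)\<^sup>2) / 2)"
  define b where "b = (\<Sum>i\<in>I. n i $ 1 * n i $ 2)"
  obtain r s where rs: "a = r * cos s" "b = r * sin s"
    using polar_Ex by metis
  define t where "t = - s / 2"
  define u :: "real^2" where "u = vector [cos t, sin t]"
  define v :: "real^2" where "v = vector [- sin t, cos t]"
  have "(n i \<bullet> u) * (n i \<bullet> v)
      = (n i $ 1 * n i $ 2) * cos (2 * t) + ((n i $ 2)\<^sup>2 - (n i $ 1)\<^sup>2) / 2 * sin (2 * t)" for i
  proof -
    have "(n i \<bullet> u) * (n i \<bullet> v)
        = (n i $ 1 * n i $ 2) * ((cos t)\<^sup>2 - (sin t)\<^sup>2)
          + ((n i $ 2)\<^sup>2 - (n i $ 1)\<^sup>2) * (sin t * cos t)"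
      by (simp add: u_def v_def inner_vec_def sum_2 power2_eq_square algebra_simps)
    then show ?thesis
      by (simp add: cos_double sin_double)
  qed
  then have "(\<Sum>i\<in>I. (n i \<bullet> u) * (n i \<bullet> v)) = b * cos (2 * t) + a * sin (2 * t)"
    unfolding a_def b_def by (simp add: sum.distrib sum_distrib_right)
  also have "\<dots> = 0"
    by (simp add: t_def rs)
  finally show ?thesis
    by (intro that[of u v])
       (auto simp: u_def v_def norm_eq_1 orthogonal_def inner_vec_def sum_2 simp flip: power2_eq_square)
qed

text \<open>
  Without a mixed term the two variables separate, and the minimum can be found in each coordinate
  on its own: the centre \<open>c\<close> makes the residuals \<open>e i = n i \<bullet> c - d i\<close> orthogonal to both coefficient
  families \<open>n i \<bullet> u\<close> and \<open>n i \<bullet> v\<close>, as in a least squares problem.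
\<close>
lemma sum_squares_complete_square:
  fixes n :: "'i \<Rightarrow> 'a::real_inner"
  assumes cross: "(\<Sum>i\<in>I. (n i \<bullet> u) * (n i \<bullet> v)) = 0"
    and p: "p = (\<Sum>i\<in>I. (n i \<bullet> u)\<^sup>2)" "p \<noteq> 0" and q: "q = (\<Sum>i\<in>I. (n i \<bullet> v)\<^sup>2)" "q \<noteq> 0"
  obtains c m where
    "\<And>x y. (\<Sum>i\<in>I. (n i \<bullet> (c + x *\<^sub>R u + y *\<^sub>R v) - d i)\<^sup>2) = m + p * x\<^sup>2 + q * y\<^sup>2"
proof -
  define x0 where "x0 = (\<Sum>i\<in>I. d i * (n i \<bullet> u)) / p"
  define y0 where "y0 = (\<Sum>i\<in>I. d i * (n i \<bullet> v)) / q"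
  define c where "c = x0 *\<^sub>R u + y0 *\<^sub>R v"
  define e where "e i = n i \<bullet> c - d i" for i
  have "(\<Sum>i\<in>I. (n i \<bullet> u) * e i)
      = (\<Sum>i\<in>I. x0 * (n i \<bullet> u)\<^sup>2 + y0 * ((n i \<bullet> u) * (n i \<bullet> v)) - d i * (n i \<bullet> u))"
    by (rule sum.cong)
       (auto simp: e_def c_def inner_add_right power2_eq_square algebra_simps)
  also have "\<dots> = x0 * p + y0 * 0 - (\<Sum>i\<in>I. d i * (n i \<bullet> u))"
    by (simp only: sum.distrib sum_subtractf sum_distrib_left[symmetric] p(1)[symmetric] cross)
  also have "\<dots> = 0" using p(2) by (simp add: x0_def)
  finally have eu: "(\<Sum>i\<in>I. (n i \<bullet> u) * e i) = 0" .
  have "(\<Sum>i\<in>I. (n i \<bullet> v) * e i)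
      = (\<Sum>i\<in>I. x0 * ((n i \<bullet> u) * (n i \<bullet> v)) + y0 * (n i \<bullet> v)\<^sup>2 - d i * (n i \<bullet> v))"
    by (rule sum.cong)
       (auto simp: e_def c_def inner_add_right power2_eq_square algebra_simps)
  also have "\<dots> = x0 * 0 + y0 * q - (\<Sum>i\<in>I. d i * (n i \<bullet> v))"
    by (simp only: sum.distrib sum_subtractf sum_distrib_left[symmetric] q(1)[symmetric] cross)
  also have "\<dots> = 0" using q(2) by (simp add: y0_def)
  finally have ev: "(\<Sum>i\<in>I. (n i \<bullet> v) * e i) = 0" .
  have "(\<Sum>i\<in>I. (n i \<bullet> (c + x *\<^sub>R u + y *\<^sub>R v) - d i)\<^sup>2)
      = (\<Sum>i\<in>I. (e i)\<^sup>2) + p * x\<^sup>2 + q * y\<^sup>2" for x y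
  proof -
    have "(\<Sum>i\<in>I. (n i \<bullet> (c + x *\<^sub>R u + y *\<^sub>R v) - d i)\<^sup>2)
      = (\<Sum>i\<in>I. (e i)\<^sup>2 + x\<^sup>2 * (n i \<bullet> u)\<^sup>2 + y\<^sup>2 * (n i \<bullet> v)\<^sup>2
          + 2 * x * y * ((n i \<bullet> u) * (n i \<bullet> v)) + 2 * x * ((n i \<bullet> u) * e i) + 2 * y * ((n i \<bullet> v) * e i))"
      by (rule sum.cong)
         (auto simp: e_def inner_add_right power2_eq_square algebra_simps)
    also have "\<dots> = (\<Sum>i\<in>I. (e i)\<^sup>2) + x\<^sup>2 * p + y\<^sup>2 * q + 2 * x * y * 0 + 2 * x * 0 + 2 * y * 0"
      by (simp only: sum.distrib sum_distrib_left[symmetric] p(1)[symmetric] q(1)[symmetric] cross eu ev)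
    finally show ?thesis by simp
  qed
  then show ?thesis by (rule that)
qed

text \<open>
  Outside its centre the function exceeds its minimum \<open>m\<close>. Of two distinct points on the level \<open>k\<close> at
  least one is not the centre, and this forces \<open>k > m\<close>.
\<close>
lemma level_set_of_sum_squares_is_ellipse:
  fixes n :: "'i \<Rightarrow> real^2"
  assumes "finite I"
    and definite: "\<And>w. (\<And>i. i \<in> I \<Longrightarrow> n i \<bullet> w = 0) \<Longrightarrow> w = 0"
    and P: "(\<Sum>i\<in>I. (n i \<bullet> P - d i)\<^sup>2) = k" and Q: "(\<Sum>i\<in>I. (n i \<bullet> Q - d i)\<^sup>2) = k"
    and "P \<noteq> Q"
  shows "is_ellipse {X. (\<Sum>i\<in>I. (n i \<bullet> X - d i)\<^sup>2) = k}"
proof -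
  define form where "form w = (\<Sum>i\<in>I. (n i \<bullet> w)\<^sup>2)" for w
  have form_pos: "form w > 0" if "w \<noteq> 0" for w
  proof -
    have "form w \<noteq> 0"
      using definite[of w] that \<open>finite I\<close> by (auto simp: form_def sum_nonneg_eq_0_iff)
    then show ?thesis by (simp add: form_def sum_nonneg less_le)
  qed
  obtain u v where uv: "norm u = 1" "norm v = 1" "orthogonal u v"
    and cross: "(\<Sum>i\<in>I. (n i \<bullet> u) * (n i \<bullet> v)) = 0" and le: "form u \<le> form v"
  proof -
    obtain u v where *: "norm u = 1" "norm v = 1" "orthogonal u v"
      "(\<Sum>i\<in>I. (n i \<bullet> u) * (n i \<bullet> v)) = 0"
      by (rule diagonalizing_frame_exists)
    \<comment> \<open>Exchanging the axes puts the smaller coefficient, hence the longer semi-axis, first.\<close>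
    show thesis
      using that[of u v] that[of v u] * by (cases "form u \<le> form v") (auto simp: orthogonal_commute
          mult.commute)
  qed
  define p q where "p = form u" and "q = form v"
  have "u \<noteq> 0" "v \<noteq> 0" using uv by auto
  then have pq: "p > 0" "q > 0" "p \<le> q"
    using form_pos[of u] form_pos[of v] uv le unfolding p_def q_def by auto
  define F where "F X = (\<Sum>i\<in>I. (n i \<bullet> X - d i)\<^sup>2)" for X
  obtain c m where F: "\<And>x y. F (c + x *\<^sub>R u + y *\<^sub>R v) = m + p * x\<^sup>2 + q * y\<^sup>2"
    unfolding F_def
    by (rule sum_squares_complete_square[OF cross, of p q d]) (use pq in \<open>auto simp: p_def q_def form_def\<close>)
  have F_gt: "F X > m" if "X \<noteq> c" for X
  proof -
    obtain x y where X: "X = c + x *\<^sub>R u + y *\<^sub>R v" using orthonormal_frame_coordinates[OF uv] by blast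
    then have "x \<noteq> 0 \<or> y \<noteq> 0" using that by auto
    then have "p * x\<^sup>2 + q * y\<^sup>2 > 0"
      using pq by (auto intro: add_pos_nonneg add_nonneg_pos)
    then show ?thesis unfolding X F by simp
  qed
  have km: "k > m"
    using F_gt[of P] F_gt[of Q] P Q \<open>P \<noteq> Q\<close> by (cases "P = c") (auto simp: F_def)
  define \<alpha> \<beta> where "\<alpha> = sqrt ((k - m) / p)" and "\<beta> = sqrt ((k - m) / q)"
  have radii: "\<alpha> > 0" "\<beta> > 0" "p * \<alpha>\<^sup>2 = k - m" "q * \<beta>\<^sup>2 = k - m"
    using pq km by (auto simp: \<alpha>_def \<beta>_def)
  have "\<beta> \<le> \<alpha>"
    using pq km by (auto simp: \<alpha>_def \<beta>_def intro!: divide_left_mono)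
  then have "is_ellipse {c + x *\<^sub>R u + y *\<^sub>R v |x y. x\<^sup>2 / \<alpha>\<^sup>2 + y\<^sup>2 / \<beta>\<^sup>2 = 1}"
    by (rule is_ellipseI[OF uv _ radii(2)])
  then have "is_ellipse {X. F X = k}"
    by (simp only: level_set_in_frame[of u v F c m p q, OF uv F radii(1,2) km radii(3,4)])
  then show ?thesis by (simp add: F_def)
qed

section \<open>The locus of a triangle\<close>

lemma sq_dist_locus_is_ellipse:
  assumes nc: "\<not> collinear {A, B, C}"
    and "P \<in> sq_dist_locus A B C k" "Q \<in> sq_dist_locus A B C k" "P \<noteq> Q"
  shows "is_ellipse (sq_dist_locus A B C k)"
proof -
  have ne: "B \<noteq> C" "C \<noteq> A" "A \<noteq> B"
    using nc by (auto simp: insert_commute)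
  obtain n1 n2 n3 where n: "norm n1 = 1" "n1 \<bullet> (C - B) = 0" "norm n2 = 1" "n2 \<bullet> (A - C) = 0"
    "norm n3 = 1" "n3 \<bullet> (B - A) = 0"
    by (metis perp_unit_vector_exists)
  define nn where "nn i = [n1, n2, n3] ! i" for i
  define d where "d i = [n1 \<bullet> B, n2 \<bullet> C, n3 \<bullet> A] ! i" for i
  have sum3: "(\<Sum>i\<in>{0,1,2}. f i) = f 0 + f 1 + f 2" for f :: "nat \<Rightarrow> real"
    by simp
  have eq: "sq_dist_locus A B C k = {X. (\<Sum>i\<in>{0,1,2}. (nn i \<bullet> X - d i)\<^sup>2) = k}" 
    unfolding sum3 nn_def d_def
    using sq_dist_locus_by_normals[OF n(1,3,5) ne refl _ refl _ refl] n
    by (simp add: inner_diff_right)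
  have definite: "w = 0" if w: "\<And>i. i \<in> {0,1,2} \<Longrightarrow> nn i \<bullet> w = 0" for w
  proof (rule ccontr)
    assume "w \<noteq> 0"
    \<comment> \<open>Two sides parallel to \<open>w\<close> already force the three vertices onto one line.\<close>
    have "n1 \<bullet> w = 0" "n2 \<bullet> w = 0"
      using w[of 0] w[of 1] by (auto simp: nn_def)
    then obtain a b where "C - B = a *\<^sub>R w" "A - C = b *\<^sub>R w"
      using perp_to_same_vector_parallel[of n1 w "C - B"] perp_to_same_vector_parallel[of n2 w "A - C"]
        n \<open>w \<noteq> 0\<close> by fastforce
    then have "C = B + a *\<^sub>R w" "A = B + (a + b) *\<^sub>R w" "B = B + 0 *\<^sub>R w"
      by (auto simp: algebra_simps)
    then have "\<forall>X\<in>{A, B, C}. \<exists>t. X = B + t *\<^sub>R w" by blast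
    then show False using nc collinear_alt by blast
  qed
  show ?thesis
    unfolding eq
    by (rule level_set_of_sum_squares_is_ellipse[where P=P and Q=Q])
       (use definite assms(2-4) in \<open>simp_all only: eq mem_Collect_eq finite_insert finite.emptyI not_False_eq_True\<close>)
qed

text \<open>
  Put the origin at the centre \<open>z\<close> and let the legs of the isosceles triangle, with normals
  \<open>s v \<plusminus> c u\<close>, have distance 1 from it. The gradient of the sum of squares vanishes at \<open>z\<close> exactly if
  the base lies on the line \<open>y = - 2 s\<close>. The apex is then \<open>(0, 1 / s)\<close>, the legs meet the base at
  \<open>x = \<plusminus> (1 + 2 s\<^sup>2) / c\<close>, and the minimum of the sum is \<open>4 s\<^sup>2 + 2\<close>.
\<close>
lemma ellipse_is_sq_dist_locus:
  assumes "is_ellipse E"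
  shows "\<exists>A B C k. \<not> collinear {A, B, C} \<and> k > 0 \<and> E = sq_dist_locus A B C k"
proof -
  obtain z u v \<alpha> \<beta> where uv: "norm u = 1" "norm v = 1" "orthogonal u v"
    and ab: "\<alpha> \<ge> \<beta>" "\<beta> > 0"
    and E: "E = {z + x *\<^sub>R u + y *\<^sub>R v |x y. x\<^sup>2 / \<alpha>\<^sup>2 + y\<^sup>2 / \<beta>\<^sup>2 = 1}"
    using assms unfolding is_ellipse_def by (elim exE conjE) (rule that)
  have inner_uv [simp]: "u \<bullet> u = 1" "v \<bullet> v = 1" "u \<bullet> v = 0" "v \<bullet> u = 0"
    using uv by (auto simp: norm_eq_1 orthogonal_def inner_commute)
  define D where "D = \<alpha>\<^sup>2 + \<beta>\<^sup>2"
  have "\<alpha> > 0" "\<beta>\<^sup>2 \<le> \<alpha>\<^sup>2" "\<beta>\<^sup>2 > 0" "D > 0"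
    using ab by (auto simp: D_def add_pos_pos)
  \<comment> \<open>The solution of \<open>2 c\<^sup>2 \<alpha>\<^sup>2 = (1 + 2 s\<^sup>2) \<beta>\<^sup>2\<close> and \<open>c\<^sup>2 + s\<^sup>2 = 1\<close>.\<close>
  define s c where "s = sqrt ((2 * \<alpha>\<^sup>2 - \<beta>\<^sup>2) / (2 * D))" and "c = sqrt (3 * \<beta>\<^sup>2 / (2 * D))"
  have sc: "s > 0" "c > 0"
    and s2: "s\<^sup>2 = (2 * \<alpha>\<^sup>2 - \<beta>\<^sup>2) / (2 * D)" and c2: "c\<^sup>2 = 3 * \<beta>\<^sup>2 / (2 * D)"
  proof -
    have "2 * \<alpha>\<^sup>2 - \<beta>\<^sup>2 > 0"
      using \<open>\<beta>\<^sup>2 \<le> \<alpha>\<^sup>2\<close> \<open>\<beta>\<^sup>2 > 0\<close> by linarith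
    then have "(2 * \<alpha>\<^sup>2 - \<beta>\<^sup>2) / (2 * D) > 0" "3 * \<beta>\<^sup>2 / (2 * D) > 0"
      using \<open>\<beta>\<^sup>2 > 0\<close> \<open>D > 0\<close> by simp_all
    then show "s > 0" "c > 0" "s\<^sup>2 = (2 * \<alpha>\<^sup>2 - \<beta>\<^sup>2) / (2 * D)" "c\<^sup>2 = 3 * \<beta>\<^sup>2 / (2 * D)"
      unfolding s_def c_def by simp_all
  qed
  have unit: "c\<^sup>2 + s\<^sup>2 = 1"
    using \<open>D > 0\<close> unfolding s2 c2 by (simp add: field_simps) (simp add: D_def algebra_simps)
  define h where "h = (1 + 2 * s\<^sup>2) / c"
  define A where "A = z + (1 / s) *\<^sub>R v"
  define B where "B = z - h *\<^sub>R u - (2 * s) *\<^sub>R v"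
  define C where "C = z + h *\<^sub>R u - (2 * s) *\<^sub>R v"
  define n2 where "n2 = c *\<^sub>R u + s *\<^sub>R v"
  define n3 where "n3 = s *\<^sub>R v - c *\<^sub>R u"
  define k where "k = 4 * s\<^sup>2 + 2 + 3 * \<alpha>\<^sup>2 * \<beta>\<^sup>2 / D"
  have h: "h > 0" "c * h = 1 + 2 * s\<^sup>2"
  proof -
    have "1 + 2 * s\<^sup>2 > 0" by (simp add: add_pos_nonneg)
    then show "h > 0" "c * h = 1 + 2 * s\<^sup>2"
      using sc by (simp_all add: h_def)
  qed
  have norms: "norm n2 = 1" "norm n3 = 1"
    using unit by (auto simp: norm_eq_1 n2_def n3_def inner_add_left inner_add_right inner_diff_left
        inner_diff_right power2_eq_square)
  have nc: "\<not> collinear {A, B, C}"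
  proof
    assume "collinear {A, B, C}"
    then obtain w where w: "\<forall>X\<in>{A,B,C}. \<forall>Y\<in>{A,B,C}. \<exists>t. X - Y = t *\<^sub>R w"
      unfolding collinear_def by blast
    then obtain t t' where t: "C - B = t *\<^sub>R w" "A - B = t' *\<^sub>R w" by blast
    have "C - B = (2 * h) *\<^sub>R u" "A - B = h *\<^sub>R u + (1 / s + 2 * s) *\<^sub>R v"
      unfolding A_def B_def C_def by (simp_all add: scaleR_add_left flip: scaleR_2)
    then have "v \<bullet> (C - B) = 0" "u \<bullet> (C - B) = 2 * h" "v \<bullet> (A - B) = 1 / s + 2 * s"
      by (simp_all add: inner_add_right)
    then have "t * (v \<bullet> w) = 0" "t * (u \<bullet> w) = 2 * h" "t' * (v \<bullet> w) = 1 / s + 2 * s"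
      unfolding t by auto
    moreover have "1 / s + 2 * s > 0" using sc by (auto intro: add_pos_pos)
    ultimately show False using h by auto
  qed
  then have ne: "B \<noteq> C" "C \<noteq> A" "A \<noteq> B"
    by (auto simp: insert_commute)
  have locus: "sq_dist_locus A B C k = {P. (v \<bullet> P - (v \<bullet> z - 2 * s))\<^sup>2
      + (n2 \<bullet> P - (n2 \<bullet> z + 1))\<^sup>2 + (n3 \<bullet> P - (n3 \<bullet> z + 1))\<^sup>2 = k}"
    by (rule sq_dist_locus_by_normals[OF uv(2) norms ne])
       (use sc h in \<open>auto simp: A_def B_def C_def n2_def n3_def inner_add_left inner_add_right
          inner_diff_left inner_diff_right power2_eq_square algebra_simps\<close>)
  have "(v \<bullet> (z + x *\<^sub>R u + y *\<^sub>R v) - (v \<bullet> z - 2 * s))\<^sup>2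
      + (n2 \<bullet> (z + x *\<^sub>R u + y *\<^sub>R v) - (n2 \<bullet> z + 1))\<^sup>2
      + (n3 \<bullet> (z + x *\<^sub>R u + y *\<^sub>R v) - (n3 \<bullet> z + 1))\<^sup>2
      = 4 * s\<^sup>2 + 2 + 2 * c\<^sup>2 * x\<^sup>2 + (1 + 2 * s\<^sup>2) * y\<^sup>2" for x y
    by (simp add: n2_def n3_def inner_add_left inner_add_right
          inner_diff_left inner_diff_right power2_eq_square algebra_simps)
  then have "sq_dist_locus A B C k = E"
    unfolding locus E
  proof (rule level_set_in_frame[OF uv _ \<open>\<alpha> > 0\<close> ab(2)])
    show "k > 4 * s\<^sup>2 + 2"
      using \<open>\<alpha> > 0\<close> ab(2) \<open>D > 0\<close> by (simp add: k_def)
    show "2 * c\<^sup>2 * \<alpha>\<^sup>2 = k - (4 * s\<^sup>2 + 2)"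
      using \<open>D > 0\<close> by (simp add: k_def c2)
    have "1 + 2 * s\<^sup>2 = 3 * \<alpha>\<^sup>2 / D"
      using \<open>D > 0\<close> unfolding s2 by (simp add: field_simps) (simp add: D_def algebra_simps)
    then show "(1 + 2 * s\<^sup>2) * \<beta>\<^sup>2 = k - (4 * s\<^sup>2 + 2)"
      by (simp add: k_def)
  qed
  moreover have "k > 0"
    using \<open>D > 0\<close> sc unfolding k_def by (intro add_pos_nonneg) auto
  ultimately show ?thesis using nc by blast
qed

theorem theorem3:
  shows "(\<forall>(A::real^2) B C (k::real).
            \<not> collinear {A, B, C} \<and> k > 0 \<and>
            (\<exists>P\<in>sq_dist_locus A B C k. \<exists>Q\<in>sq_dist_locus A B C k. P \<noteq> Q)
            \<longrightarrow> is_ellipse (sq_dist_locus A B C k))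
       \<and> (\<forall>E. is_ellipse E \<longrightarrow>
            (\<exists>(A::real^2) B C (k::real).
               \<not> collinear {A, B, C} \<and> k > 0 \<and> E = sq_dist_locus A B C k))"
  using sq_dist_locus_is_ellipse ellipse_is_sq_dist_locus by blast

end
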